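(* Let $D\subset\mathbb{C}^d$ be a bounded homogeneous domain and let $\{f_n\}_{n\in\mathbb{N}}$ be a sequence of Bloch functions on $D$ which converges locally uniformly in $D$ to some holomorphic function $f$. If the sequence $\{\beta_{f_n}\}$ is bounded, then $f$ is Bloch and $$\beta_f\le\liminf_{n\to\infty}\beta_{f_n}.$$ That is, the function $f\mapsto\beta_f$ is lower semi-continuous on the Bloch space $\mathcal{B}$ of $D$ under the topology of uniform convergence on compact subsets of $D$.
   Context: A domain $D\subset\mathbb{C}^d$ is homogeneous if its group $\mathrm{Aut}(D)$ of biholomorphic self-maps acts transitively on $D$. For a bounded homogeneous domain $D$, $H_z(u,\overline v)$ ($z\in D$, $u,v\in\mathbb{C}^d$) denotes the Bergman metric, a positive definite Hermitian form invariant under automorphisms, normalized by $H_z(u,\overline v)=\frac12\sum_{j,k}\frac{\partial^2\log K(z,z)}{\partial z_j\partial\overline{z_k}}u_j\overline{v_k}$ with $K$ the Bergman kernel of $D$ (so on the unit disk $H_z(u,\overline u)=|u|^2/(1-|z|^2)^2$). For holomorphic $f:D\to\mathbb{C}$ put $Q_f(z)=\sup_{u\ne0}|(\nabla f)(z)u|/H_z(u,\overline u)^{1/2}$ with $(\nabla f)(z)u=\sum_k\frac{\partial f}{\partial z_k}(z)u_k$, and $\beta_f=\sup_{z\in D}Q_f(z)$. The function $f$ is Bloch if $\beta_f<\infty$, and $\mathcal{B}$ is the space of Bloch functions on $D$. *)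

theory Defs
  imports "HOL-Analysis.Analysis"
begin

section \<open>Holomorphic functions and homogeneous domains in \<open>\<complex>\<^sup>d\<close>\<close>

definition holomorphic_scv :: "(complex ^ 'd \<Rightarrow> complex) \<Rightarrow> (complex ^ 'd) set \<Rightarrow> bool" where
  "holomorphic_scv f D \<longleftrightarrow>
     (\<forall>z\<in>D. \<exists>a :: complex ^ 'd.
        (f has_derivative (\<lambda>u. \<Sum>k\<in>UNIV. a $ k * u $ k)) (at z within D))"

definition holomorphic_map_scv :: "(complex ^ 'd \<Rightarrow> complex ^ 'm) \<Rightarrow> (complex ^ 'd) set \<Rightarrow> bool" where
  "holomorphic_map_scv \<phi> D \<longleftrightarrow> (\<forall>i. holomorphic_scv (\<lambda>z. \<phi> z $ i) D)"

definition is_domain :: "(complex ^ 'd) set \<Rightarrow> bool" where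
  "is_domain D \<longleftrightarrow> open D \<and> connected D \<and> D \<noteq> {}"

definition Aut :: "(complex ^ 'd) set \<Rightarrow> (complex ^ 'd \<Rightarrow> complex ^ 'd) set" where
  "Aut D = {\<phi>. bij_betw \<phi> D D \<and> holomorphic_map_scv \<phi> D \<and>
                holomorphic_map_scv (inv_into D \<phi>) D}"

definition homogeneous_domain :: "(complex ^ 'd) set \<Rightarrow> bool" where
  "homogeneous_domain D \<longleftrightarrow>
     is_domain D \<and> (\<forall>z\<in>D. \<forall>w\<in>D. \<exists>\<phi>\<in>Aut D. \<phi> z = w)"

section \<open>Bergman kernel\<close>

definition bergman_space :: "(complex ^ 'd) set \<Rightarrow> (complex ^ 'd \<Rightarrow> complex) set" where
  "bergman_space D =
     {f. holomorphic_scv f D \<and> set_integrable lborel D (\<lambda>z. (cmod (f z))\<^sup>2)}"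

definition is_bergman_kernel ::
    "(complex ^ 'd) set \<Rightarrow> (complex ^ 'd \<Rightarrow> complex ^ 'd \<Rightarrow> complex) \<Rightarrow> bool" where
  "is_bergman_kernel D K \<longleftrightarrow>
     (\<forall>w\<in>D. (\<lambda>z. K z w) \<in> bergman_space D) \<and>
     (\<forall>f\<in>bergman_space D. \<forall>w\<in>D. f w = (LINT z:D|lborel. f z * cnj (K z w)))"

text \<open>The reproducing property determines the kernel on \<open>D \<times> D\<close>; it is set to zero elsewhere
  so that it is unique as a total function.\<close>

definition bergman_kernel ::
    "(complex ^ 'd) set \<Rightarrow> complex ^ 'd \<Rightarrow> complex ^ 'd \<Rightarrow> complex" where
  "bergman_kernel D =
     (THE K. is_bergman_kernel D K \<and> (\<forall>z w. z \<notin> D \<or> w \<notin> D \<longrightarrow> K z w = 0))"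

section \<open>Bergman metric\<close>

text \<open>The Wirtinger operators
  \<open>\<partial>/\<partial>z\<^sub>j = (\<partial>/\<partial>x\<^sub>j - \<i> \<partial>/\<partial>y\<^sub>j) / 2\<close> and
  \<open>(\<partial>/\<partial>x\<^sub>j + \<i> \<partial>/\<partial>y\<^sub>j) / 2\<close>,
  the derivative in the conjugate variable, where \<open>z\<^sub>j = x\<^sub>j + \<i> y\<^sub>j\<close>.\<close>

definition dir_deriv :: "(complex ^ 'd \<Rightarrow> complex) \<Rightarrow> complex ^ 'd \<Rightarrow> complex ^ 'd \<Rightarrow> complex" where
  "dir_deriv g v z = vector_derivative (\<lambda>t::real. g (z + t *\<^sub>R v)) (at 0)"

definition wirtinger :: "'d \<Rightarrow> (complex ^ 'd \<Rightarrow> complex) \<Rightarrow> complex ^ 'd \<Rightarrow> complex" where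
  "wirtinger j g z = (dir_deriv g (axis j 1) z - \<i> * dir_deriv g (axis j \<i>) z) / 2"

definition wirtinger_bar :: "'d \<Rightarrow> (complex ^ 'd \<Rightarrow> complex) \<Rightarrow> complex ^ 'd \<Rightarrow> complex" where
  "wirtinger_bar j g z = (dir_deriv g (axis j 1) z + \<i> * dir_deriv g (axis j \<i>) z) / 2"

text \<open>\<open>bergman_metric D z u v\<close> is \<open>H\<^sub>z(u, cnj v)\<close>: the conjugation of the second argument
  is built in. The diagonal values \<open>K(z,z)\<close> are positive reals on a bounded domain.\<close>

definition bergman_metric ::
    "(complex ^ 'd) set \<Rightarrow> complex ^ 'd \<Rightarrow> complex ^ 'd \<Rightarrow> complex ^ 'd \<Rightarrow> complex" where
  "bergman_metric D z u v =
     1/2 * (\<Sum>j\<in>UNIV. \<Sum>k\<in>UNIV.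
       wirtinger j (wirtinger_bar k (\<lambda>w. complex_of_real (ln (Re (bergman_kernel D w w))))) z
         * u $ j * cnj (v $ k))"

section \<open>Bloch functions\<close>

definition partial_deriv :: "'d \<Rightarrow> (complex ^ 'd \<Rightarrow> complex) \<Rightarrow> complex ^ 'd \<Rightarrow> complex" where
  "partial_deriv k f z = deriv (\<lambda>t. f (z + axis k t)) 0"

definition grad_apply :: "(complex ^ 'd \<Rightarrow> complex) \<Rightarrow> complex ^ 'd \<Rightarrow> complex ^ 'd \<Rightarrow> complex" where
  "grad_apply f z u = (\<Sum>k\<in>UNIV. partial_deriv k f z * u $ k)"

definition bloch_Q :: "(complex ^ 'd) set \<Rightarrow> (complex ^ 'd \<Rightarrow> complex) \<Rightarrow> complex ^ 'd \<Rightarrow> ereal" where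
  "bloch_Q D f z =
     (SUP u\<in>{u. u \<noteq> 0}. ereal (cmod (grad_apply f z u) / sqrt (Re (bergman_metric D z u u))))"

definition bloch_beta :: "(complex ^ 'd) set \<Rightarrow> (complex ^ 'd \<Rightarrow> complex) \<Rightarrow> ereal" where
  "bloch_beta D f = (SUP z\<in>D. bloch_Q D f z)"

definition bloch_space :: "(complex ^ 'd) set \<Rightarrow> (complex ^ 'd \<Rightarrow> complex) set" where
  "bloch_space D = {f. holomorphic_scv f D \<and> bloch_beta D f < \<infinity>}"

section \<open>Modes of convergence and semi-continuity\<close>

definition locally_uniform_limit ::
    "(complex ^ 'd) set \<Rightarrow> (nat \<Rightarrow> complex ^ 'd \<Rightarrow> complex) \<Rightarrow> (complex ^ 'd \<Rightarrow> complex) \<Rightarrow> bool" where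
  "locally_uniform_limit D F f \<longleftrightarrow>
     (\<forall>z\<in>D. \<exists>U. open U \<and> z \<in> U \<and> U \<subseteq> D \<and> uniform_limit U F f sequentially)"

text \<open>The topology of uniform convergence on compact subsets of \<open>D\<close>, on all functions.
  Functions agreeing on \<open>D\<close> are topologically indistinguishable, so the values outside \<open>D\<close>
  are irrelevant.\<close>

definition compact_convergence_topology ::
    "(complex ^ 'd) set \<Rightarrow> (complex ^ 'd \<Rightarrow> complex) topology" where
  "compact_convergence_topology D = topology (\<lambda>\<U>.
     \<forall>f\<in>\<U>. \<exists>C e. compact C \<and> C \<subseteq> D \<and> 0 < e \<and> {g. \<forall>z\<in>C. dist (g z) (f z) < e} \<subseteq> \<U>)"

lemma openin_compact_convergence_topology:
  fixes D :: "(complex ^ 'd) set"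
  shows "openin (compact_convergence_topology D) \<U> \<longleftrightarrow>
     (\<forall>f\<in>\<U>. \<exists>C e. compact C \<and> C \<subseteq> D \<and> 0 < e \<and> {g. \<forall>z\<in>C. dist (g z) (f z) < e} \<subseteq> \<U>)"
proof -
  define N where "N f \<U> \<longleftrightarrow> (\<exists>C e. compact C \<and> C \<subseteq> D \<and> 0 < e \<and>
      {g. \<forall>z\<in>C. dist (g z) (f z) < e} \<subseteq> \<U>)" for f :: "complex ^ 'd \<Rightarrow> complex" and \<U>
  have mono: "N f T" if "N f S" "S \<subseteq> T" for f S T
    using that unfolding N_def by (meson order_trans)
  have int: "N f (S \<inter> T)" if "N f S" and "N f T" for f S T
  proof -
    obtain C e where 1: "compact C" "C \<subseteq> D" "0 < e" "{g. \<forall>z\<in>C. dist (g z) (f z) < e} \<subseteq> S"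
      using \<open>N f S\<close> unfolding N_def by (elim exE conjE)
    obtain C' e' where 2: "compact C'" "C' \<subseteq> D" "0 < e'" "{g. \<forall>z\<in>C'. dist (g z) (f z) < e'} \<subseteq> T"
      using \<open>N f T\<close> unfolding N_def by (elim exE conjE)
    have "{g. \<forall>z\<in>C \<union> C'. dist (g z) (f z) < min e e'} \<subseteq> S \<inter> T"
    proof
      fix g assume "g \<in> {g. \<forall>z\<in>C \<union> C'. dist (g z) (f z) < min e e'}"
      then have "g \<in> {g. \<forall>z\<in>C. dist (g z) (f z) < e}" "g \<in> {g. \<forall>z\<in>C'. dist (g z) (f z) < e'}"
        by simp_all
      then show "g \<in> S \<inter> T" using 1(4) 2(4) by (intro IntI) (erule (1) subsetD[rotated])+
    qed
    moreover have "compact (C \<union> C')" "C \<union> C' \<subseteq> D" "0 < min e e'"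
      using 1 2 by (simp_all add: compact_Un)
    ultimately show ?thesis unfolding N_def by (intro exI conjI)
  qed
  have "istopology (\<lambda>\<U>. \<forall>f\<in>\<U>. N f \<U>)"
    unfolding istopology_def
  proof (intro conjI allI impI ballI)
    fix S T f assume "\<forall>f\<in>S. N f S" "\<forall>f\<in>T. N f T" "f \<in> S \<inter> T"
    then show "N f (S \<inter> T)" by (intro int) simp_all
  next
    fix \<K> f assume K: "\<forall>S\<in>\<K>. \<forall>f\<in>S. N f S" and "f \<in> \<Union>\<K>"
    then obtain S where "S \<in> \<K>" "f \<in> S" by (elim UnionE)
    then show "N f (\<Union>\<K>)" using K mono[of f S, OF _ Union_upper] by simp
  qed
  moreover have "compact_convergence_topology D = topology (\<lambda>\<U>. \<forall>f\<in>\<U>. N f \<U>)"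
    unfolding compact_convergence_topology_def N_def ..
  ultimately have "openin (compact_convergence_topology D) \<U> \<longleftrightarrow> (\<forall>f\<in>\<U>. N f \<U>)"
    by (simp only: topology_inverse')
  then show ?thesis unfolding N_def .
qed

definition lower_semicontinuous_map :: "'a topology \<Rightarrow> ('a \<Rightarrow> ereal) \<Rightarrow> bool" where
  "lower_semicontinuous_map X h \<longleftrightarrow> (\<forall>a. openin X {x \<in> topspace X. a < h x})"

end

theory Submission
  imports Defs "HOL-Complex_Analysis.Cauchy_Integral_Formula"
begin

text \<open>For a fixed point \<open>z \<in> D\<close> and a fixed direction \<open>u \<noteq> 0\<close>, the quotient
  \<open>|(\<nabla>f)(z)u| / H\<^sub>z(u, cnj u)\<^sup>1\<^sup>/\<^sup>2\<close> depends continuously on the holomorphic function \<open>f\<close>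
  in the topology of compact convergence: its denominator does not involve \<open>f\<close>, and by Cauchy's
  inequality on the coordinate discs through \<open>z\<close> its numerator is controlled by the values of \<open>f\<close>
  on a closed ball around \<open>z\<close> (\<open>grad_apply_diff_le\<close>). The seminorm \<open>\<beta>\<^sub>f\<close> is the supremum of these
  quotients over \<open>z\<close> and \<open>u\<close> (\<open>bloch_beta_eq_SUP_quotient\<close>), and a supremum of continuous
  functions is lower semi-continuous, both along sequences and in the topological sense. That
  the limit function is Bloch then follows from the bound on the \<open>\<beta>\<close> of the sequence.\<close>

section \<open>Continuity of the gradient under compact convergence\<close>

lemma norm_axis_complex: "norm (axis k t :: complex ^ 'd) = norm t"
  by (simp add: norm_vec_def L2_set_def axis_def if_distrib[of norm] if_distrib[of "\<lambda>x. x\<^sup>2"]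
      cong: if_cong)

lemma holomorphic_scv_slice:
  fixes f :: "complex ^ 'd \<Rightarrow> complex"
  assumes "open D" and "holomorphic_scv f D"
  shows "(\<lambda>t. f (z + axis k t)) holomorphic_on {t. z + axis k t \<in> D}"
proof -
  have "(\<lambda>t. f (z + axis k t)) field_differentiable (at t)" if tD: "z + axis k t \<in> D" for t
  proof -
    obtain a where "(f has_derivative (\<lambda>u. \<Sum>j\<in>UNIV. a $ j * u $ j)) (at (z + axis k t) within D)"
      using assms(2) tD unfolding holomorphic_scv_def by blast
    then have f': "(f has_derivative (\<lambda>u. \<Sum>j\<in>UNIV. a $ j * u $ j)) (at (z + axis k t))"
      using at_within_open[OF tD assms(1)] by simp
    have "linear (axis k :: complex \<Rightarrow> complex ^ 'd)"
      by (rule linearI) (simp_all add: axis_def vec_eq_iff)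
    then have "bounded_linear (axis k :: complex \<Rightarrow> complex ^ 'd)"
      by (simp add: linear_conv_bounded_linear)
    then have "((\<lambda>t. z + axis k t) has_derivative axis k) (at t)"
      by (auto intro!: derivative_eq_intros bounded_linear_imp_has_derivative)
    from has_derivative_compose[OF this f']
    have "((\<lambda>t. f (z + axis k t)) has_derivative (\<lambda>s. \<Sum>j\<in>UNIV. a $ j * axis k s $ j)) (at t)" .
    also have "(\<lambda>s. \<Sum>j\<in>UNIV. a $ j * axis k s $ j) = (*) (a $ k)"
      by (simp add: axis_def if_distrib cong: if_cong)
    finally show ?thesis
      unfolding field_differentiable_def has_field_derivative_def by blast
  qed
  then show ?thesis
    unfolding holomorphic_on_def by (auto intro: field_differentiable_at_within)
qed

text \<open>This is Cauchy's inequality for the first derivative of \<open>f - g\<close> restricted to the disc of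
  radius \<open>r\<close> about \<open>z\<close> in the \<open>k\<close>-th coordinate direction.\<close>

lemma partial_deriv_diff_le:
  fixes f g :: "complex ^ 'd \<Rightarrow> complex"
  assumes "open D" and f: "holomorphic_scv f D" and g: "holomorphic_scv g D"
    and "0 < r" and ball: "cball z r \<subseteq> D"
    and close: "\<And>w. w \<in> cball z r \<Longrightarrow> dist (f w) (g w) \<le> e"
  shows "cmod (partial_deriv k f z - partial_deriv k g z) \<le> e / r"
proof -
  let ?F = "\<lambda>t. f (z + axis k t)" and ?G = "\<lambda>t. g (z + axis k t)"
  have in_ball: "z + axis k t \<in> cball z r" if "cmod t \<le> r" for t
    using that by (simp add: dist_norm norm_axis_complex)
  have hol: "?F holomorphic_on cball 0 r" "?G holomorphic_on cball 0 r"
    using in_ball ball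
    by (auto intro!: holomorphic_on_subset[OF holomorphic_scv_slice[OF \<open>open D\<close> f]]
        holomorphic_on_subset[OF holomorphic_scv_slice[OF \<open>open D\<close> g]])
  have "(\<lambda>t. ?F t - ?G t) holomorphic_on cball 0 r"
    using hol by (intro holomorphic_intros)
  then have "cmod ((deriv ^^ 1) (\<lambda>t. ?F t - ?G t) 0) \<le> fact 1 * e / r ^ 1"
    using \<open>0 < r\<close> close in_ball
    by (intro Cauchy_inequality)
       (auto intro: holomorphic_on_subset holomorphic_on_imp_continuous_on simp: dist_norm)
  moreover have "deriv (\<lambda>t. ?F t - ?G t) 0 = deriv ?F 0 - deriv ?G 0"
    using hol[THEN holomorphic_on_subset, OF ball_subset_cball] \<open>0 < r\<close>
    by (intro deriv_diff) (auto intro: holomorphic_on_imp_differentiable_at)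
  ultimately show ?thesis
    by (simp add: partial_deriv_def)
qed

lemma grad_apply_diff_le:
  fixes f g :: "complex ^ 'd \<Rightarrow> complex"
  assumes "open D" and "holomorphic_scv f D" and "holomorphic_scv g D"
    and "0 < r" and "cball z r \<subseteq> D"
    and "\<And>w. w \<in> cball z r \<Longrightarrow> dist (f w) (g w) \<le> e"
  shows "cmod (grad_apply f z u - grad_apply g z u) \<le> e * ((\<Sum>k\<in>UNIV. cmod (u $ k)) / r)"
proof -
  have "cmod (grad_apply f z u - grad_apply g z u)
      = cmod (\<Sum>k\<in>UNIV. (partial_deriv k f z - partial_deriv k g z) * u $ k)"
    by (simp add: grad_apply_def sum_subtractf left_diff_distrib)
  also have "\<dots> \<le> (\<Sum>k\<in>UNIV. e / r * cmod (u $ k))"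
    using partial_deriv_diff_le[OF assms]
    by (intro sum_norm_le) (simp only: norm_mult mult_right_mono norm_ge_zero)
  also have "\<dots> = e * ((\<Sum>k\<in>UNIV. cmod (u $ k)) / r)"
    by (simp add: sum_distrib_left sum_divide_distrib)
  finally show ?thesis .
qed

section \<open>The Bloch seminorm as a supremum of continuous functionals\<close>

definition bloch_quotient ::
    "(complex ^ 'd) set \<Rightarrow> complex ^ 'd \<Rightarrow> complex ^ 'd \<Rightarrow> (complex ^ 'd \<Rightarrow> complex) \<Rightarrow> real" where
  "bloch_quotient D z u f = cmod (grad_apply f z u) / sqrt (Re (bergman_metric D z u u))"

lemma bloch_beta_eq_SUP_quotient:
  "bloch_beta D f = (SUP z\<in>D. SUP u\<in>{u. u \<noteq> 0}. ereal (bloch_quotient D z u f))"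
  by (simp add: bloch_beta_def bloch_Q_def bloch_quotient_def)

lemma bloch_quotient_le_beta:
  assumes "z \<in> D" and "u \<noteq> 0"
  shows "ereal (bloch_quotient D z u f) \<le> bloch_beta D f"
  unfolding bloch_beta_eq_SUP_quotient using assms by (auto intro!: SUP_upper2)

text \<open>The denominator of the quotient is the same for \<open>f\<close> and \<open>g\<close>, so the linear estimate for the
  gradient carries over. The constant \<open>L\<close> depends only on \<open>z\<close>, \<open>u\<close> and \<open>r\<close>, which is what makes
  the quotient continuous in the function.\<close>

lemma bloch_quotient_lipschitz:
  fixes D :: "(complex ^ 'd) set"
  assumes "open D" and "0 < r" and "cball z r \<subseteq> D"
  obtains L where "0 < L"
    and "\<And>f g e. \<lbrakk>holomorphic_scv f D; holomorphic_scv g D;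
            \<And>w. w \<in> cball z r \<Longrightarrow> dist (f w) (g w) \<le> e\<rbrakk>
          \<Longrightarrow> \<bar>bloch_quotient D z u f - bloch_quotient D z u g\<bar> \<le> e * L"
proof
  let ?m = "sqrt (Re (bergman_metric D z u u))" and ?S = "(\<Sum>k\<in>UNIV. cmod (u $ k)) / r"
  (* The sum vanishes for u = 0, and so does the quotient for a zero denominator; adding 1 keeps
     the constant positive, so that tolerances can be divided by it. *)
  let ?L = "?S / \<bar>?m\<bar> + 1"
  have S: "0 \<le> ?S" using \<open>0 < r\<close> by (simp add: sum_nonneg)
  then show "0 < ?L"
    by (meson add_nonneg_pos divide_nonneg_nonneg abs_ge_zero zero_less_one)
  fix f g e
  assume fg: "holomorphic_scv f D" "holomorphic_scv g D"
    and close: "\<And>w. w \<in> cball z r \<Longrightarrow> dist (f w) (g w) \<le> e"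
  have "0 \<le> e"
    using order_trans[OF zero_le_dist close[of z]] \<open>0 < r\<close> by simp
  have "\<bar>bloch_quotient D z u f - bloch_quotient D z u g\<bar>
      = \<bar>cmod (grad_apply f z u) - cmod (grad_apply g z u)\<bar> / \<bar>?m\<bar>"
    by (simp only: bloch_quotient_def abs_divide flip: diff_divide_distrib)
  also have "\<dots> \<le> (e * ?S) / \<bar>?m\<bar>"
    using norm_triangle_ineq3[of "grad_apply f z u" "grad_apply g z u"]
      grad_apply_diff_le[OF \<open>open D\<close> fg assms(2,3) close, of u]
    by (intro divide_right_mono) linarith+
  also have "\<dots> \<le> e * ?L"
    using \<open>0 \<le> e\<close> by (simp add: distrib_left)
  finally show "\<bar>bloch_quotient D z u f - bloch_quotient D z u g\<bar> \<le> e * ?L" .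
qed

section \<open>Lower semi-continuity\<close>

lemma bloch_quotient_tendsto:
  fixes D :: "(complex ^ 'd) set"
  assumes "open D" and "\<And>n. holomorphic_scv (F n) D" and "holomorphic_scv f D"
    and "locally_uniform_limit D F f" and "z \<in> D"
  shows "(\<lambda>n. bloch_quotient D z u (F n)) \<longlonglongrightarrow> bloch_quotient D z u f"
proof -
  obtain U where U: "open U" "z \<in> U" "U \<subseteq> D" "uniform_limit U F f sequentially"
    using assms(4,5) unfolding locally_uniform_limit_def by blast
  then obtain r where r: "0 < r" "cball z r \<subseteq> U"
    by (meson open_contains_cball)
  then have rD: "cball z r \<subseteq> D" using U by blast
  obtain L where L: "0 < L"
    and lip: "\<And>f g e. \<lbrakk>holomorphic_scv f D; holomorphic_scv g D;
            \<And>w. w \<in> cball z r \<Longrightarrow> dist (f w) (g w) \<le> e\<rbrakk>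
          \<Longrightarrow> \<bar>bloch_quotient D z u f - bloch_quotient D z u g\<bar> \<le> e * L"
    using bloch_quotient_lipschitz[OF \<open>open D\<close> r(1) rD] by blast
  show ?thesis
  proof (rule tendstoI)
    fix e :: real assume "0 < e"
    (* The factor 1/2 turns the non-strict Lipschitz bound into a strict one. *)
    define d where "d = e / (2 * L)"
    have d: "0 < d" "d * L < e" using \<open>0 < e\<close> L by (simp_all add: d_def)
    have "\<forall>\<^sub>F n in sequentially. \<forall>w\<in>U. dist (F n w) (f w) < d"
      using U(4) d(1) by (rule uniform_limitD)
    then show "\<forall>\<^sub>F n in sequentially. dist (bloch_quotient D z u (F n)) (bloch_quotient D z u f) < e"
    proof eventually_elim
      case (elim n)
      then have "\<bar>bloch_quotient D z u (F n) - bloch_quotient D z u f\<bar> \<le> d * L"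
        using r(2) by (intro lip assms) force
      then show ?case using d(2) by (simp add: dist_real_def)
    qed
  qed
qed

lemma bloch_beta_le_liminf:
  fixes D :: "(complex ^ 'd) set"
  assumes "open D" and "\<And>n. holomorphic_scv (F n) D" and "holomorphic_scv f D"
    and "locally_uniform_limit D F f"
  shows "bloch_beta D f \<le> liminf (\<lambda>n. bloch_beta D (F n))"
  unfolding bloch_beta_eq_SUP_quotient[of D f]
proof (intro SUP_least)
  fix z u :: "complex ^ 'd" assume zu: "z \<in> D" "u \<in> {u. u \<noteq> 0}"
  have "(\<lambda>n. ereal (bloch_quotient D z u (F n))) \<longlonglongrightarrow> ereal (bloch_quotient D z u f)"
    using bloch_quotient_tendsto[OF assms zu(1)] by simp
  then have "ereal (bloch_quotient D z u f) = liminf (\<lambda>n. ereal (bloch_quotient D z u (F n)))"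
    by (intro lim_imp_Liminf[symmetric]) simp_all
  also have "\<dots> \<le> liminf (\<lambda>n. bloch_beta D (F n))"
    using zu by (intro Liminf_mono always_eventually allI bloch_quotient_le_beta) simp_all
  finally show "ereal (bloch_quotient D z u f) \<le> liminf (\<lambda>n. bloch_beta D (F n))" .
qed

text \<open>The set \<open>{g. \<forall>z\<in>C. dist (g z) (f z) < e}\<close> itself need not be open, because for a
  discontinuous \<open>g\<close> the supremum of the distance over \<open>C\<close> may equal \<open>e\<close>. Bounding this supremum
  strictly below \<open>e\<close> leaves room for a further perturbation.\<close>

lemma openin_compact_convergence_tube:
  assumes "compact C" and "C \<subseteq> D"
  shows "openin (compact_convergence_topology D) {g. \<exists>s<e. \<forall>z\<in>C. dist (g z) (f z) \<le> s}"
  unfolding openin_compact_convergence_topology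
proof
  fix g assume "g \<in> {g. \<exists>s<e. \<forall>z\<in>C. dist (g z) (f z) \<le> s}"
  then obtain s where s: "s < e" "\<forall>z\<in>C. dist (g z) (f z) \<le> s" by blast
  have "\<exists>s<e. \<forall>z\<in>C. dist (h z) (f z) \<le> s" if h: "\<forall>z\<in>C. dist (h z) (g z) < (e - s) / 2" for h
  proof (intro exI conjI ballI)
    show "s + (e - s) / 2 < e" using s(1) by (simp add: field_simps)
    fix z assume "z \<in> C"
    then show "dist (h z) (f z) \<le> s + (e - s) / 2"
      using bspec[OF h \<open>z \<in> C\<close>] bspec[OF s(2) \<open>z \<in> C\<close>] dist_triangle[of "h z" "f z" "g z"] by linarith
  qed
  moreover have "0 < (e - s) / 2" using s(1) by simp
  ultimately show "\<exists>K e'. compact K \<and> K \<subseteq> D \<and> 0 < e' \<and>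
      {h. \<forall>z\<in>K. dist (h z) (g z) < e'} \<subseteq> {g. \<exists>s<e. \<forall>z\<in>C. dist (g z) (f z) \<le> s}"
    using assms by blast
qed

lemma lower_semicontinuous_bloch_beta:
  fixes D :: "(complex ^ 'd) set"
  assumes "open D"
  shows "lower_semicontinuous_map
           (subtopology (compact_convergence_topology D) (bloch_space D)) (bloch_beta D)"
proof -
  let ?T = "compact_convergence_topology D"
  let ?X = "subtopology ?T (bloch_space D)"
  have "openin ?T UNIV"
    unfolding openin_compact_convergence_topology
    by (intro ballI exI[of _ "{}"] exI[of _ 1]) simp
  then have "topspace ?T = UNIV"
    using openin_subset by blast
  then have top: "topspace ?X = bloch_space D" by (simp add: topspace_subtopology)
  have "openin ?X {f \<in> bloch_space D. a < bloch_beta D f}" for a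
  proof (subst openin_subopen, intro ballI)
    fix f assume f: "f \<in> {f \<in> bloch_space D. a < bloch_beta D f}"
    then obtain z u where z: "z \<in> D" and u: "u \<noteq> 0" and a: "a < ereal (bloch_quotient D z u f)"
      by (auto simp: bloch_beta_eq_SUP_quotient less_SUP_iff)
    obtain b where b: "a < ereal b" "b < bloch_quotient D z u f"
      using ereal_dense2[OF a] by auto
    obtain r where r: "0 < r" "cball z r \<subseteq> D"
      using z \<open>open D\<close> by (meson open_contains_cball)
    obtain L where L: "0 < L"
      and lip: "\<And>f g e. \<lbrakk>holomorphic_scv f D; holomorphic_scv g D;
            \<And>w. w \<in> cball z r \<Longrightarrow> dist (f w) (g w) \<le> e\<rbrakk>
          \<Longrightarrow> \<bar>bloch_quotient D z u f - bloch_quotient D z u g\<bar> \<le> e * L"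
      using bloch_quotient_lipschitz[OF \<open>open D\<close> r] by blast
    (* A perturbation of f below e on the ball changes the quotient by less than its gap to b. *)
    define e where "e = (bloch_quotient D z u f - b) / L"
    let ?V = "{g. \<exists>s<e. \<forall>w\<in>cball z r. dist (g w) (f w) \<le> s}"
    have "0 < e" using b(2) L by (simp add: e_def)
    then have "f \<in> ?V" by auto
    have "a < bloch_beta D g" if g: "g \<in> ?V" "g \<in> bloch_space D" for g
    proof -
      obtain s where s: "s < e" "\<forall>w\<in>cball z r. dist (g w) (f w) \<le> s" using g(1) by blast
      have "\<bar>bloch_quotient D z u g - bloch_quotient D z u f\<bar> \<le> s * L"
        using f g s(2) by (intro lip) (auto simp: bloch_space_def)
      also have "\<dots> < bloch_quotient D z u f - b"
        using s(1) L by (simp add: e_def pos_less_divide_eq)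
      finally have "b \<le> bloch_quotient D z u g" by linarith
      then have "a < ereal (bloch_quotient D z u g)"
        using b(1) by (meson ereal_less_eq(3) less_le_trans)
      also have "\<dots> \<le> bloch_beta D g" using z u by (rule bloch_quotient_le_beta)
      finally show ?thesis .
    qed
    moreover have "openin ?X (bloch_space D \<inter> ?V)"
      by (intro openin_subtopology_Int2 openin_compact_convergence_tube compact_cball r(2))
    ultimately show "\<exists>W. openin ?X W \<and> f \<in> W \<and> W \<subseteq> {f \<in> bloch_space D. a < bloch_beta D f}"
      using f \<open>f \<in> ?V\<close> by (intro exI[of _ "bloch_space D \<inter> ?V"]) blast
  qed
  then show ?thesis unfolding lower_semicontinuous_map_def top by blast
qed

theorem theorem3p5:
  fixes D :: "(complex ^ 'd) set"
  assumes "bounded D" and "homogeneous_domain D"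
  shows "(\<forall>(F :: nat \<Rightarrow> complex ^ 'd \<Rightarrow> complex) f.
            (\<forall>n. F n \<in> bloch_space D) \<longrightarrow>
            holomorphic_scv f D \<longrightarrow>
            locally_uniform_limit D F f \<longrightarrow>
            (\<exists>B::real. \<forall>n. bloch_beta D (F n) \<le> ereal B) \<longrightarrow>
            f \<in> bloch_space D \<and> bloch_beta D f \<le> liminf (\<lambda>n. bloch_beta D (F n)))
         \<and> lower_semicontinuous_map
             (subtopology (compact_convergence_topology D) (bloch_space D)) (bloch_beta D)"
proof (intro conjI[OF _ lower_semicontinuous_bloch_beta] allI impI)
  show "open D"
    using assms(2) by (simp add: homogeneous_domain_def is_domain_def)
  fix F :: "nat \<Rightarrow> complex ^ 'd \<Rightarrow> complex" and f
  assume F: "\<forall>n. F n \<in> bloch_space D" and f: "holomorphic_scv f D"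
    and lim: "locally_uniform_limit D F f"
    and "\<exists>B::real. \<forall>n. bloch_beta D (F n) \<le> ereal B"
  then obtain B :: real where B: "\<And>n. bloch_beta D (F n) \<le> ereal B" by blast
  have le: "bloch_beta D f \<le> liminf (\<lambda>n. bloch_beta D (F n))"
    using F by (intro bloch_beta_le_liminf[OF \<open>open D\<close> _ f lim]) (simp add: bloch_space_def)
  also have "\<dots> \<le> ereal B"
    using Liminf_le[of sequentially "\<lambda>n. bloch_beta D (F n)" "ereal B"] B by simp
  also have "\<dots> < \<infinity>" by simp
  finally show "f \<in> bloch_space D \<and> bloch_beta D f \<le> liminf (\<lambda>n. bloch_beta D (F n))"
    using f le by (simp add: bloch_space_def)
qed

end
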